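(* Let $n\ge 1$, let $l_1,\dots,l_n>0$, and let $\Pi^n=\{z\in\mathbb{R}^n: 0\le z_s\le l_s,\ 1\le s\le n\}$. Let $f:\mathbb{R}^n\times\mathbb{T}^n\to[0,\infty)$ be a Lebesgue integrable function with $\int_{\mathbb{R}^n}\int_{\mathbb{T}^n}f(\omega,x)\,d^nx\,d^n\omega=1$ (the density at time $t=0$ of the distribution of the particles of a collisionless gas in $\Pi^n$, in the covering coordinates). Let $G\subset\Pi^n$ be a Jordan measurable domain. Let $K(t)$ be the fraction of gas particles located in $G$ at time $t$, that is, $$K(t)=\int_{\mathbb{R}^n}\int_{\mathbb{T}^n} f(\omega,\,x-\omega t)\,\mathbf{1}_G(\zeta(x))\,d^nx\,d^n\omega ,$$ where $\zeta:\mathbb{T}^n\to\Pi^n$ is the folding covering map. Then $$\lim_{t\to\pm\infty}K(t)=\frac{\operatorname{mes}G}{\operatorname{mes}\Pi^n}.$$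
   Context: $\mathbb{T}^n=(\mathbb{R}/2\pi\mathbb{Z})^n$ with Lebesgue measure $d^nx$ of total mass $(2\pi)^n$, and $x-\omega t$ is taken modulo $2\pi$; $\operatorname{mes}$ denotes $n$-dimensional volume and $\mathbf{1}_G$ the characteristic function of $G$. Noninteracting gas particles move in $\Pi^n$ with constant velocity and reflect elastically from the walls. The box $\Pi^n$ has a $2^n$-sheeted covering $\zeta:\mathbb{T}^n\to\Pi^n$, branched over the boundary of $\Pi^n$, given coordinatewise, for $x_s\in[0,2\pi]$, by $\zeta(x)_s=l_sx_s/\pi$ if $0\le x_s\le\pi$, and $\zeta(x)_s=l_s(2\pi-x_s)/\pi$ if $\pi\le x_s\le 2\pi$. In the coordinates $x\in\mathbb{T}^n$ and $\omega\in\mathbb{R}^n$ ($\omega_s=\pi v_s/l_s$, where $v_s$ are velocity components) the motion of the particles is $\dot x_s=\omega_s$, $\dot\omega_s=0$, so the density at time $t$ is $f(\omega,x-\omega t)$. *)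

theory Defs
  imports "HOL-Analysis.Analysis" "HOL-Library.Real_Mod"
begin

text \<open>
  A point of the torus \<open>(\<real>/2\<pi>\<int>)\<^sup>n\<close> is represented by its unique representative in
  \<open>[0,2\<pi>)\<^sup>n\<close>. A function on the torus is a function on \<^typ>\<open>real ^ 'n\<close> of which only the
  values on this cube are ever used, and the measure on the torus is Lebesgue measure
  on the cube, of total mass \<open>(2\<pi>)\<^sup>n\<close>.
\<close>

definition torus :: "(real ^ 'n) set" where
  "torus = {x. \<forall>s. 0 \<le> x $ s \<and> x $ s < 2 * pi}"

definition torus_class :: "real ^ 'n \<Rightarrow> real ^ 'n" where
  "torus_class x = (\<chi> s. (x $ s) rmod (2 * pi))"

definition gas_box :: "real ^ 'n \<Rightarrow> (real ^ 'n) set" where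
  "gas_box l = {z. \<forall>s. 0 \<le> z $ s \<and> z $ s \<le> l $ s}"

text \<open>Meaningful for coordinates in \<open>[0,2\<pi>]\<close> only; it is applied to points of \<^const>\<open>torus\<close>.\<close>

definition fold_map :: "real ^ 'n \<Rightarrow> real ^ 'n \<Rightarrow> real ^ 'n" where
  "fold_map l x =
     (\<chi> s. if x $ s \<le> pi then l $ s * x $ s / pi else l $ s * (2 * pi - x $ s) / pi)"

text \<open>
  The frontier of a bounded set is compact, so it is Lebesgue null if and only if it has
  Jordan content zero.
\<close>

definition jordan_measurable :: "'a::euclidean_space set \<Rightarrow> bool" where
  "jordan_measurable S \<longleftrightarrow> bounded S \<and> negligible (frontier S)"

definition gas_fraction ::
    "real ^ 'n \<Rightarrow> ((real ^ 'n) \<times> (real ^ 'n) \<Rightarrow> real) \<Rightarrow> (real ^ 'n) set \<Rightarrow> real \<Rightarrow> real" where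
  "gas_fraction l f G t =
     (LINT \<omega>|lebesgue. (LINT x:torus|lebesgue.
        f (\<omega>, torus_class (x - t *\<^sub>R \<omega>)) * indicator G (fold_map l x)))"

end

theory Submission
  imports Defs
begin

text \<open>
  Let \<open>h\<close> be the indicator of \<open>G\<close> composed with the folding map. Boosting all velocities by
  \<open>- a / t\<close> leaves \<open>K(t)\<close> unchanged, and at time \<open>t\<close> it amounts to rotating the positions by
  \<open>a\<close>, up to an error \<open>\<parallel>f(\<cdot> - a / t, \<cdot>) - f\<parallel>\<close> in \<open>L\<^sup>1\<close>. By continuity of translations in
  \<open>L\<^sup>1\<close> this error tends to \<open>0\<close> uniformly in \<open>a\<close>, so \<open>K(t)\<close> is asymptotic to its average over
  all rotations \<open>a\<close>, which by Fubini is the mean of \<open>h\<close> over the torus. On each of its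
  \<open>2\<^sup>n\<close> sheets the folding map is affine with the same constant Jacobian, so that mean is
  \<open>mes G / mes \<Pi>\<^sup>n\<close>. Jordan measurability of \<open>G\<close> is used only to replace \<open>G\<close> by its interior,
  which is Borel.
\<close>

section \<open>Continuity of translation in the mean\<close>

lemma lborel_integral_translate:
  fixes f :: "'a::euclidean_space \<Rightarrow> 'b::{banach, second_countable_topology}"
  assumes "f \<in> borel_measurable borel"
  shows "(LINT x|lborel. f (x + b)) = (LINT x|lborel. f x)"
proof -
  have "(LINT x|lborel. f x) = (LINT x|distr lborel borel ((+) b). f x)"
    by (simp add: lborel_distr_plus)
  also have "\<dots> = (LINT x|lborel. f (b + x))"
    using assms by (subst integral_distr) auto
  finally show ?thesis by (simp add: add.commute)
qed

lemma lborel_nn_integral_translate: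
  fixes f :: "'a::euclidean_space \<Rightarrow> ennreal"
  assumes "f \<in> borel_measurable borel"
  shows "(\<integral>\<^sup>+x. f (x + b) \<partial>lborel) = (\<integral>\<^sup>+x. f x \<partial>lborel)"
proof -
  have "(\<integral>\<^sup>+x. f x \<partial>lborel) = (\<integral>\<^sup>+x. f x \<partial>distr lborel borel ((+) b))"
    by (simp add: lborel_distr_plus)
  also have "\<dots> = (\<integral>\<^sup>+x. f (b + x) \<partial>lborel)"
    using assms by (subst nn_integral_distr) auto
  finally show ?thesis by (simp add: add.commute)
qed

lemma integrable_lborel_translate:
  fixes f :: "'a::euclidean_space \<Rightarrow> real"
  assumes f: "integrable lborel f"
  shows "integrable lborel (\<lambda>x. f (x + b))"
proof -
  have m[measurable]: "f \<in> borel_measurable borel"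
    using borel_measurable_integrable[OF f] by simp
  have "(\<integral>\<^sup>+x. ennreal (norm (f (x + b))) \<partial>lborel) = (\<integral>\<^sup>+x. ennreal (norm (f x)) \<partial>lborel)"
    by (rule lborel_nn_integral_translate[where f = "\<lambda>x. ennreal (norm (f x))"]) measurable
  with f show ?thesis
    unfolding integrable_iff_bounded by simp
qed

text \<open>Regularity of Lebesgue measure from both sides, each spending half of \<open>e\<close>.
  Its purpose: a shift shorter than the distance from \<open>K\<close> to the complement of
  \<open>U\<close> can alter the indicator of \<open>A\<close> only near
  \<open>U - K\<close>.\<close>

lemma compact_open_sandwich_lborel:
  fixes A :: "'a::euclidean_space set"
  assumes A: "A \<in> sets borel" "emeasure lborel A < \<infinity>" and "0 < e"
  obtains K U where "compact K" "open U" "K \<subseteq> A" "A \<subseteq> U"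
    "emeasure lborel (U - K) < ennreal e"
proof -
  obtain U where U: "open U" "A \<subseteq> U" "emeasure lborel (U - A) < ennreal (e/2)"
    using outer_regular_lborel[OF A(1), of "e/2"] \<open>0 < e\<close> by auto
  \<comment> \<open>Inner regularity is only available for finite measures, hence the restriction of \<open>lborel\<close> to \<open>A\<close>.\<close>
  let ?D = "density lborel (indicator A)"
  have em: "emeasure ?D B = emeasure lborel (A \<inter> B)" if "B \<in> sets borel" for B
    using A(1) that by (simp add: emeasure_density flip: indicator_inter_arith)
  have "emeasure ?D (space ?D) \<noteq> \<infinity>"
    using A em[of UNIV] by simp
  then have "emeasure ?D A = (SUP K \<in> {K. K \<subseteq> A \<and> compact K}. emeasure ?D K)"
    using A by (intro inner_regular) auto
  then have sup: "emeasure lborel A = (SUP K \<in> {K. K \<subseteq> A \<and> compact K}. emeasure ?D K)"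
    using em A by simp
  obtain K where K: "K \<subseteq> A" "compact K" "emeasure lborel A < emeasure lborel K + ennreal (e/2)"
  \<comment> \<open>The comparison of \<open>m - e/2\<close> with \<open>m\<close> passes through
    \<open>ennreal\<close>, which truncates at 0 and so stays strict only for
    \<open>m > 0\<close>.\<close>
  proof (cases "emeasure lborel A = 0")
    case True
    then show ?thesis using that[of "{}"] \<open>0 < e\<close> by simp
  next
    case False
    define m where "m = measure lborel A"
    have m: "emeasure lborel A = ennreal m" "0 < m"
      using A False by (auto simp: m_def emeasure_eq_ennreal_measure zero_less_measure_iff)
    have "ennreal (m - e/2) < (SUP K \<in> {K. K \<subseteq> A \<and> compact K}. emeasure ?D K)"
      unfolding sup[symmetric] m(1) using m(2) \<open>0 < e\<close> by (intro ennreal_lessI) auto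
    then obtain K where K: "K \<subseteq> A" "compact K" "ennreal (m - e/2) < emeasure ?D K"
      by (auto simp: less_SUP_iff)
    have Kb: "K \<in> sets borel" using K(2) by (simp add: borel_compact)
    have "emeasure ?D K = emeasure lborel K"
      using em[OF Kb] K(1) by (simp add: Int_absorb1)
    then have "ennreal (m - e/2) < emeasure lborel K"
      using K(3) by simp
    moreover have fin: "emeasure lborel K < \<infinity>"
      using emeasure_compact_finite[OF K(2)] .
    ultimately have "m - e/2 < measure lborel K"
      by (metis emeasure_eq_ennreal_measure ennreal_less_iff ennreal_neg linorder_not_less measure_nonneg nle_le not_less_zero order_less_imp_not_eq2 infinity_ennreal_def ennreal_leI)
    then have "ennreal m < ennreal (measure lborel K + e/2)"
      using m \<open>0 < e\<close> by (intro ennreal_lessI) (auto simp: add_nonneg_pos)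
    then have "emeasure lborel A < emeasure lborel K + ennreal (e/2)"
      using fin \<open>0 < e\<close> m by (simp add: emeasure_eq_ennreal_measure ennreal_plus less_top)
    with K that show ?thesis by blast
  qed
  have Kb: "K \<in> sets borel" using K(2) by (simp add: borel_compact)
  have "emeasure lborel K + emeasure lborel (A - K) = emeasure lborel A"
    using K Kb A plus_emeasure[of K lborel "A - K"] by (simp add: Un_absorb1)
  with K(3) have AK: "emeasure lborel (A - K) < ennreal (e/2)"
    by (metis ennreal_add_left_cancel_less)
  have "emeasure lborel (U - K) \<le> emeasure lborel ((U - A) \<union> (A - K))"
    using U A Kb by (intro emeasure_mono) auto
  also have "\<dots> \<le> emeasure lborel (U - A) + emeasure lborel (A - K)"
    using U A Kb by (intro emeasure_subadditive) auto
  also have "\<dots> < ennreal (e/2) + ennreal (e/2)"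
    using U(3) AK by (intro add_strict_mono)
  also have "\<dots> = ennreal e"
    using \<open>0 < e\<close> by (simp flip: ennreal_plus)
  finally show ?thesis
    using that K U by blast
qed

text \<open>The property holds for indicators of sets of finite measure by regularity, and it
  survives sums and dominated limits, hence reaches every integrable function by induction.\<close>

lemma continuity_of_translation_L1:
  fixes f :: "'a::euclidean_space \<Rightarrow> real"
  assumes "integrable lborel f"
  shows "((\<lambda>b. LINT x|lborel. \<bar>f (x + b) - f x\<bar>) \<longlongrightarrow> 0) (at 0)"
  using assms
proof (induction rule: integrable_induct)
  case (base A c)
  show ?case
  proof (rule tendstoI)
    fix e :: real assume "0 < e"
    \<comment> \<open>The final estimate is \<open>\<bar>c\<bar> * (2 * e')\<close>, which is
      \<open>\<bar>c\<bar> / (\<bar>c\<bar> + 1) * e\<close>; the summand 1 allows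
      \<open>c = 0\<close> and keeps the bound strict.\<close>
    define e' where "e' = e / (2 * (\<bar>c\<bar> + 1))"
    have "0 < e'" using \<open>0 < e\<close> by (simp add: e'_def)
    from base have A: "A \<in> sets borel" "emeasure lborel A < \<infinity>" by auto
    obtain K U where KU: "compact K" "open U" "K \<subseteq> A" "A \<subseteq> U"
      "emeasure lborel (U - K) < ennreal e'"
      using compact_open_sandwich_lborel[OF A \<open>0 < e'\<close>] by blast
    \<comment> \<open>A compact set has positive distance from a disjoint closed set.\<close>
    have "\<exists>d>0. \<forall>x\<in>K. \<forall>y\<in>-U. d \<le> dist x y"
      using KU by (intro separate_compact_closed) auto
    then obtain d where d: "d > 0" "\<And>x y. x \<in> K \<Longrightarrow> y \<notin> U \<Longrightarrow> d \<le> dist x y" by auto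
    have UKb: "U - K \<in> sets borel" using KU by (auto intro: borel_compact)
    have bound: "(LINT x|lborel. \<bar>indicator A (x + b) *\<^sub>R c - indicator A x *\<^sub>R c\<bar>) < e"
      if b: "norm b < d" for b
    proof -
      let ?J = "\<lambda>x. indicat_real (U - K) x"
      \<comment> \<open>If exactly one of \<open>x\<close> and \<open>x + b\<close> is in
        \<open>A\<close>, at least one of them is in \<open>U - K\<close>: either the point in
        \<open>A\<close> misses \<open>K\<close>, or it is in \<open>K\<close> and the short shift
        keeps the other point in \<open>U\<close>.\<close>
      have pt: "\<bar>indicat_real A (x + b) *\<^sub>R c - indicator A x *\<^sub>R c\<bar> \<le> \<bar>c\<bar> * (?J x + ?J (x + b))" for x
      proof -
        have "x + b \<in> U" if "x \<in> K"
          using d(2)[OF that, of "x + b"] b by (auto simp: dist_norm)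
        moreover have "x \<in> U" if "x + b \<in> K"
          using d(2)[OF that, of "x"] b by (auto simp: dist_norm)
        ultimately show ?thesis
          using KU(3,4) by (auto simp: indicator_def)
      qed
      have intJ: "integrable lborel ?J"
        using UKb KU(5) by (intro integrable_real_indicator) (auto intro: less_trans)
      have intJb: "integrable lborel (\<lambda>x. ?J (x + b))"
        by (rule integrable_lborel_translate[OF intJ])
      have iJ: "(LINT x|lborel. ?J x) < e'"
        using UKb KU(5) \<open>0 < e'\<close> by (simp add: measure_def enn2real_less_iff less_trans[OF _ ennreal_less_top])
      have "(LINT x|lborel. \<bar>indicator A (x + b) *\<^sub>R c - indicator A x *\<^sub>R c\<bar>)
          \<le> (LINT x|lborel. \<bar>c\<bar> * (?J x + ?J (x + b)))"
        by (rule integral_mono_AE') (use intJ intJb pt in auto)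
      also have "\<dots> = \<bar>c\<bar> * ((LINT x|lborel. ?J x) + (LINT x|lborel. ?J (x + b)))"
        using intJ intJb by simp
      also have "(LINT x|lborel. ?J (x + b)) = (LINT x|lborel. ?J x)"
        using UKb by (intro lborel_integral_translate) simp
      also have "\<bar>c\<bar> * ((LINT x|lborel. ?J x) + (LINT x|lborel. ?J x)) \<le> \<bar>c\<bar> * (2 * e')"
        using iJ by (intro mult_left_mono) auto
      also have "\<dots> = \<bar>c\<bar> / (\<bar>c\<bar> + 1) * e"
        by (simp add: e'_def divide_simps)
      also have "\<dots> < e"
        using \<open>0 < e\<close> by (simp add: field_simps)
      finally show ?thesis .
    qed
    show "\<forall>\<^sub>F b in at 0. dist (LINT x|lborel. \<bar>indicator A (x + b) *\<^sub>R c - indicator A x *\<^sub>R c\<bar>) 0 < e"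
      unfolding eventually_at
    proof (intro exI[of _ d] conjI ballI impI)
      fix b :: 'a assume "b \<noteq> 0 \<and> dist b 0 < d"
      then show "dist (LINT x|lborel. \<bar>indicator A (x + b) *\<^sub>R c - indicator A x *\<^sub>R c\<bar>) 0 < e"
        using bound[of b] by (simp add: dist_real_def del: real_scaleR_def)
    qed fact
  qed
next
  case (add f g)
  note int = add.hyps(1,2) integrable_lborel_translate[OF add.hyps(1)] integrable_lborel_translate[OF add.hyps(2)]
  show ?case
  proof (rule tendsto_sandwich[OF _ _ tendsto_const])
    show "((\<lambda>b. (LINT x|lborel. \<bar>f (x + b) - f x\<bar>) + (LINT x|lborel. \<bar>g (x + b) - g x\<bar>)) \<longlongrightarrow> 0) (at 0)"
      using tendsto_add[OF add.IH] by simp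
    show "\<forall>\<^sub>F b in at 0. (LINT x|lborel. \<bar>f (x + b) + g (x + b) - (f x + g x)\<bar>)
        \<le> (LINT x|lborel. \<bar>f (x + b) - f x\<bar>) + (LINT x|lborel. \<bar>g (x + b) - g x\<bar>)"
    proof (rule always_eventually, rule allI)
      fix b
      have "(LINT x|lborel. \<bar>f (x + b) + g (x + b) - (f x + g x)\<bar>)
        \<le> (LINT x|lborel. \<bar>f (x + b) - f x\<bar> + \<bar>g (x + b) - g x\<bar>)"
        using int by (intro integral_mono) auto
      also have "\<dots> = (LINT x|lborel. \<bar>f (x + b) - f x\<bar>) + (LINT x|lborel. \<bar>g (x + b) - g x\<bar>)"
        using int by simp
      finally show "(LINT x|lborel. \<bar>f (x + b) + g (x + b) - (f x + g x)\<bar>)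
        \<le> (LINT x|lborel. \<bar>f (x + b) - f x\<bar>) + (LINT x|lborel. \<bar>g (x + b) - g x\<bar>)" .
    qed
  qed auto
next
  case (lim f s)
  \<comment> \<open>The approximants satisfy \<open>norm (s i x) \<le> 2 * norm (f x)\<close>,
    whence the dominating function \<open>3 * \<bar>f x\<bar>\<close>.\<close>
  have "(\<lambda>i. LINT x|lborel. \<bar>s i x - f x\<bar>) \<longlonglongrightarrow> (LINT x|(lborel :: 'a measure). (0::real))"
  proof (rule Bochner_Integration.integral_dominated_convergence[where w = "\<lambda>x. 3 * \<bar>f x\<bar>"])
    show "AE x in lborel. (\<lambda>i. \<bar>s i x - f x\<bar>) \<longlonglongrightarrow> 0"
      using lim.hyps(2) by (intro AE_I2 tendsto_rabs_zero) (simp add: LIM_zero)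
    show "AE x in lborel. norm \<bar>s i x - f x\<bar> \<le> 3 * \<bar>f x\<bar>" for i
    proof (rule AE_I2)
      fix x :: 'a
      show "norm \<bar>s i x - f x\<bar> \<le> 3 * \<bar>f x\<bar>"
        using lim.hyps(3)[of x i] by simp
    qed
  qed (use lim.hyps in auto)
  then have conv: "(\<lambda>i. LINT x|lborel. \<bar>s i x - f x\<bar>) \<longlonglongrightarrow> 0" by simp
  show ?case
  proof (rule tendstoI)
    fix e :: real assume "0 < e"
    then have "\<forall>\<^sub>F i in sequentially. (LINT x|lborel. \<bar>s i x - f x\<bar>) < e/3"
      using conv by (intro order_tendstoD(2)[where y = 0]) auto
    then obtain i where i: "(LINT x|lborel. \<bar>s i x - f x\<bar>) < e/3"
      by (auto simp: eventually_sequentially)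
    have "\<forall>\<^sub>F b in at 0. (LINT x|lborel. \<bar>s i (x + b) - s i x\<bar>) < e/3"
      using lim.IH[of i] \<open>0 < e\<close> by (intro order_tendstoD(2)[where y = 0]) auto
    then show "\<forall>\<^sub>F b in at 0. dist (LINT x|lborel. \<bar>f (x + b) - f x\<bar>) 0 < e"
    proof eventually_elim
      case (elim b)
      note int = lim.hyps(1)[of i] lim.hyps(4) integrable_lborel_translate[OF lim.hyps(1)[of i]]
        integrable_lborel_translate[OF lim.hyps(4)]
      have mf: "(\<lambda>x. \<bar>s i x - f x\<bar>) \<in> borel_measurable borel"
        using borel_measurable_integrable[OF int(1)] borel_measurable_integrable[OF int(2)] by simp
      \<comment> \<open>Three thirds of \<open>e\<close>: the first term equals the last by
        translation invariance, and the middle one is small by induction.\<close>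
      have "(LINT x|lborel. \<bar>f (x + b) - f x\<bar>) \<le>
        (LINT x|lborel. \<bar>s i (x + b) - f (x + b)\<bar> + \<bar>s i (x + b) - s i x\<bar> + \<bar>s i x - f x\<bar>)"
        using int by (intro integral_mono) auto
      also have "\<dots> = (LINT x|lborel. \<bar>s i (x + b) - f (x + b)\<bar>)
          + (LINT x|lborel. \<bar>s i (x + b) - s i x\<bar>) + (LINT x|lborel. \<bar>s i x - f x\<bar>)"
        using int by simp
      also have "(LINT x|lborel. \<bar>s i (x + b) - f (x + b)\<bar>) = (LINT x|lborel. \<bar>s i x - f x\<bar>)"
        by (rule lborel_integral_translate[OF mf])
      finally have "(LINT x|lborel. \<bar>f (x + b) - f x\<bar>) < e"
        using elim i by linarith
      then show ?case by (simp add: dist_real_def)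
    qed
  qed
qed

section \<open>Rotations of the torus\<close>

lemma borel_measurable_vec_nth [measurable]: "(\<lambda>x::real^'n. x $ s) \<in> borel_measurable borel"
  by (intro borel_measurable_continuous_onI continuous_intros)

lemma borel_measurable_vec_lambda:
  fixes f :: "'a \<Rightarrow> 'n::finite \<Rightarrow> real"
  assumes "\<And>s. (\<lambda>x. f x s) \<in> borel_measurable M"
  shows "(\<lambda>x. \<chi> s. f x s) \<in> borel_measurable M"
  using assms by (subst borel_measurable_euclidean_space) (auto simp: Basis_vec_def inner_axis)

lemma torus_borel [measurable]: "(torus :: (real^'n) set) \<in> sets borel"
proof -
  have "torus = (\<Inter>s. {x :: real^'n. 0 \<le> x $ s}) \<inter> (\<Inter>s. {x. x $ s < 2 * pi})"
    by (auto simp: torus_def)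
  also have "\<dots> \<in> sets borel"
    by (intro sets.Int borel_closed closed_INT borel_open open_INT ballI)
      (auto intro!: closed_Collect_le open_Collect_less continuous_intros)
  finally show ?thesis .
qed

lemma torus_subset_cbox: "(torus :: (real^'n) set) \<subseteq> cbox 0 (\<chi> s. 2 * pi)"
  by (auto simp: torus_def mem_box_cart less_imp_le)

lemma emeasure_torus_finite: "emeasure lborel (torus :: (real^'n) set) < \<infinity>"
proof -
  have "emeasure lborel (torus :: (real^'n) set) \<le> emeasure lborel (cbox 0 (\<chi> s. 2 * pi) :: (real^'n) set)"
    by (intro emeasure_mono torus_subset_cbox) auto
  also have "\<dots> < \<infinity>" by (intro emeasure_compact_finite compact_cbox)
  finally show ?thesis .
qed

lemma torus_class_borel [measurable]: "torus_class \<in> borel_measurable (borel :: (real^'n) measure)"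
  unfolding torus_class_def rmod_def by (intro borel_measurable_vec_lambda) measurable

lemma torus_class_in_torus: "torus_class x \<in> torus"
  by (simp add: torus_class_def torus_def rmod_nonneg rmod_less)

section \<open>The period lattice and its fundamental cube\<close>

definition lattice_vec :: "('n \<Rightarrow> int) \<Rightarrow> real ^ 'n" where
  "lattice_vec k = (\<chi> s. 2 * pi * of_int (k s))"

lemma torus_class_minus_lattice_vec: "torus_class (x - lattice_vec k) = torus_class x"
  by (simp add: torus_class_def lattice_vec_def vec_eq_iff rmod_def diff_divide_distrib)
     (simp add: algebra_simps)

lemma torus_class_add_lattice_vec: "torus_class (x + lattice_vec k) = torus_class x"
  using torus_class_minus_lattice_vec[of "x + lattice_vec k" k] by simp

lemma torus_class_ident: "x \<in> torus \<Longrightarrow> torus_class x = x"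
  by (simp add: torus_class_def torus_def vec_eq_iff)

lemma torus_class_eq_iff: "torus_class x = torus_class y \<longleftrightarrow> (\<exists>k. x = y + lattice_vec k)"
proof
  assume *: "torus_class x = torus_class y"
  define k where "k s = \<lfloor>x $ s / (2 * pi)\<rfloor> - \<lfloor>y $ s / (2 * pi)\<rfloor>" for s
  have "x = y + lattice_vec k"
    using * by (simp add: torus_class_def lattice_vec_def vec_eq_iff rmod_def k_def algebra_simps)
  then show "\<exists>k. x = y + lattice_vec k" by blast
qed (auto simp: torus_class_add_lattice_vec)

text \<open>The cube is a fundamental domain: exactly one of its lattice translates contains
  \<open>x\<close>. The counting integral makes this a factor 1 that can be inserted into an
  integral and moved by Tonelli.\<close>

lemma nn_integral_torus_translates:
  fixes x :: "real ^ 'n"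
  shows "(\<integral>\<^sup>+k. indicator torus (x - lattice_vec k) \<partial>count_space UNIV) = 1"
proof -
  obtain k0 where k0: "torus_class x = x + lattice_vec k0"
    using torus_class_eq_iff[of "torus_class x" x] torus_class_ident[OF torus_class_in_torus] by blast
  have "x - lattice_vec k \<in> torus \<longleftrightarrow> k = (\<lambda>s. - k0 s)" for k
  proof
    assume "x - lattice_vec k \<in> torus"
    then have "x - lattice_vec k = x + lattice_vec k0"
      using torus_class_ident[of "x - lattice_vec k"] k0 by (simp add: torus_class_minus_lattice_vec)
    then have "- lattice_vec k = lattice_vec k0" by simp
    then have E: "(- lattice_vec k) $ s = lattice_vec k0 $ s" for s by simp
    have "pi * real_of_int (k s) = pi * real_of_int (- k0 s)" for s
      using E[of s] by (simp add: lattice_vec_def)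
    then have "real_of_int (k s) = real_of_int (- k0 s)" for s
      by (metis mult_left_cancel pi_neq_zero)
    then show "k = (\<lambda>s. - k0 s)"
      unfolding of_int_eq_iff by (rule ext)
  next
    assume "k = (\<lambda>s. - k0 s)"
    then have "x - lattice_vec k = torus_class x"
      by (simp add: k0 lattice_vec_def vec_eq_iff)
    then show "x - lattice_vec k \<in> torus" by (simp add: torus_class_in_torus)
  qed
  then have "(\<integral>\<^sup>+k. indicator torus (x - lattice_vec k) \<partial>count_space UNIV)
      = (\<integral>\<^sup>+k. indicator {\<lambda>s. - k0 s} k \<partial>count_space UNIV)"
    by (intro nn_integral_cong) (auto simp: indicator_def)
  then show ?thesis by (simp add: one_ennreal_def)
qed

text \<open>Built on \<open>lborel\<close> rather than \<open>lebesgue\<close>, so that compositions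
  and products stay within Borel functions; \<open>gas_borel_representative\<close> reduces Lebesgue
  measurable densities to this setting.\<close>

definition torus_measure :: "(real ^ 'n) measure" where
  "torus_measure = restrict_space lborel torus"

lemma space_torus_measure [simp]: "space torus_measure = torus"
  by (simp add: torus_measure_def space_restrict_space)

lemma finite_measure_torus: "finite_measure (torus_measure :: (real ^ 'n) measure)"
  using emeasure_torus_finite
  by (intro finite_measureI) (simp add: torus_measure_def emeasure_restrict_space less_top)

lemma borel_measurable_torus_measure:
  "f \<in> borel \<rightarrow>\<^sub>M N \<Longrightarrow> f \<in> torus_measure \<rightarrow>\<^sub>M N"
  by (simp add: torus_measure_def measurable_restrict_space1)

lemma nn_integral_torus_measure:
  "(\<integral>\<^sup>+x. f x \<partial>torus_measure) = (\<integral>\<^sup>+x. f x * indicator torus x \<partial>lborel)"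
  unfolding torus_measure_def by (subst nn_integral_restrict_space) auto

text \<open>Cut the torus along the lattice translates of its shifted copy and move each piece back.\<close>

lemma nn_integral_torus_rotation:
  fixes g :: "real ^ 'n \<Rightarrow> ennreal"
  assumes [measurable]: "g \<in> borel_measurable borel"
  shows "(\<integral>\<^sup>+x. g (torus_class (x + c)) \<partial>torus_measure) = (\<integral>\<^sup>+x. g x \<partial>torus_measure)"
proof -
  let ?I = "indicator torus :: real ^ 'n \<Rightarrow> ennreal"
  have "(\<integral>\<^sup>+x. g (torus_class (x + c)) \<partial>torus_measure)
      = (\<integral>\<^sup>+x. g (torus_class (x + c)) * ?I x \<partial>lborel)"
    by (rule nn_integral_torus_measure)
  \<comment> \<open>Insert the factor 1 at the shifted point \<open>x + c\<close>; the countability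
    of the lattice then permits interchanging sum and integral.\<close>
  also have "\<dots> = (\<integral>\<^sup>+x. (\<integral>\<^sup>+k. g (torus_class (x + c)) * ?I x * ?I (x + c - lattice_vec k) \<partial>count_space UNIV) \<partial>lborel)"
    by (simp add: nn_integral_cmult nn_integral_torus_translates)
  also have "\<dots> = (\<integral>\<^sup>+k. (\<integral>\<^sup>+x. g (torus_class (x + c)) * ?I x * ?I (x + c - lattice_vec k) \<partial>lborel) \<partial>count_space UNIV)"
    by (rule nn_integral_count_space_nn_integral) auto
  also have "\<dots> = (\<integral>\<^sup>+k. (\<integral>\<^sup>+y. g y * ?I (y - c - lattice_vec (\<lambda>s. - k s)) * ?I y \<partial>lborel) \<partial>count_space UNIV)"
  proof (rule nn_integral_cong)
    fix k :: "'n \<Rightarrow> int"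
    have neg: "lattice_vec (\<lambda>s. - k s) = - lattice_vec k"
      by (simp add: lattice_vec_def vec_eq_iff)
    \<comment> \<open>Substitute \<open>x = y - c + lattice_vec k\<close>; on the cube
      \<open>y + lattice_vec k\<close> reduces to \<open>y\<close>, so \<open>g\<close> no longer
      sees \<open>k\<close>.\<close>
    have "(\<integral>\<^sup>+x. g (torus_class (x + c)) * ?I x * ?I (x + c - lattice_vec k) \<partial>lborel)
      = (\<integral>\<^sup>+y. g (torus_class (y + lattice_vec k)) * ?I (y - c + lattice_vec k) * ?I y \<partial>lborel)"
      using lborel_nn_integral_translate[where b = "c - lattice_vec k"
          and f = "\<lambda>y. g (torus_class (y + lattice_vec k)) * ?I (y - c + lattice_vec k) * ?I y"]
      by (simp add: algebra_simps)
    also have "\<dots> = (\<integral>\<^sup>+y. g y * ?I (y - c - lattice_vec (\<lambda>s. - k s)) * ?I y \<partial>lborel)"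
      by (intro nn_integral_cong)
         (simp add: torus_class_add_lattice_vec torus_class_ident neg split: split_indicator)
    finally show "(\<integral>\<^sup>+x. g (torus_class (x + c)) * ?I x * ?I (x + c - lattice_vec k) \<partial>lborel)
      = (\<integral>\<^sup>+y. g y * ?I (y - c - lattice_vec (\<lambda>s. - k s)) * ?I y \<partial>lborel)" .
  qed
  \<comment> \<open>Replacing \<open>k\<close> by its negative brings the first indicator into the
    form of the tiling at \<open>y - c\<close>, whose sum over \<open>k\<close> is again 1.\<close>
  also have "\<dots> = (\<integral>\<^sup>+k. (\<integral>\<^sup>+y. g y * ?I (y - c - lattice_vec k) * ?I y \<partial>lborel) \<partial>count_space UNIV)"
    by (rule nn_integral_bij_count_space[where g = "\<lambda>k s. - k s" and f = "\<lambda>k. \<integral>\<^sup>+y. g y * ?I (y - c - lattice_vec k) * ?I y \<partial>lborel"])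
       (auto intro!: bij_betwI[where g = "\<lambda>k s. - k s"])
  also have "\<dots> = (\<integral>\<^sup>+y. (\<integral>\<^sup>+k. g y * ?I (y - c - lattice_vec k) * ?I y \<partial>count_space UNIV) \<partial>lborel)"
    by (rule nn_integral_count_space_nn_integral[symmetric]) auto
  also have "\<dots> = (\<integral>\<^sup>+y. g y * ?I y \<partial>lborel)"
    by (intro nn_integral_cong)
       (simp add: nn_integral_cmult nn_integral_multc nn_integral_torus_translates)
  also have "\<dots> = (\<integral>\<^sup>+x. g x \<partial>torus_measure)"
    by (rule nn_integral_torus_measure[symmetric])
  finally show ?thesis .
qed

section \<open>The folding map\<close>

text \<open>Change of variables under a diagonal affine map. The Jacobian is left as a product over
  \<open>Basis\<close>, since it cancels later in \<open>fold_map_mean\<close>.\<close>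

lemma nn_integral_lborel_affine_cart:
  fixes c t :: "real ^ 'n" and f :: "real ^ 'n \<Rightarrow> ennreal"
  assumes [measurable]: "f \<in> borel_measurable borel" and c: "\<And>s. c $ s \<noteq> 0"
  shows "(\<integral>\<^sup>+x. f x \<partial>lborel)
    = ennreal (\<Prod>j\<in>Basis. \<bar>c \<bullet> j\<bar>) * (\<integral>\<^sup>+x. f (\<chi> s. t $ s + c $ s * x $ s) \<partial>lborel)"
proof -
  define T :: "real ^ 'n \<Rightarrow> real ^ 'n"
    where "T x = t + (\<Sum>j\<in>Basis. ((c \<bullet> j) * (x \<bullet> j)) *\<^sub>R j)" for x
  have T_inner: "T x \<bullet> j = (\<chi> s. t $ s + c $ s * x $ s) \<bullet> j" if "j \<in> Basis" for x j
  proof -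
    have "T x \<bullet> j = t \<bullet> j + (c \<bullet> j) * (x \<bullet> j)"
      using that by (simp add: T_def inner_add_left inner_sum_left inner_Basis if_distrib sum.If_cases cong: if_cong)
    also have "\<dots> = (\<chi> s. t $ s + c $ s * x $ s) \<bullet> j"
      using that by (auto simp: Basis_vec_def inner_axis)
    finally show ?thesis .
  qed
  have T: "T x = (\<chi> s. t $ s + c $ s * x $ s)" for x
    by (rule euclidean_eqI) (rule T_inner)
  have [measurable]: "T \<in> borel_measurable borel"
    unfolding T_def[abs_def] by simp
  have "lborel = density (distr lborel borel T) (\<lambda>_. (\<Prod>j\<in>Basis. \<bar>c \<bullet> j\<bar>))"
    unfolding T_def[abs_def] using c
    by (intro lborel_affine_euclidean) (auto simp: Basis_vec_def inner_axis)
  then have "(\<integral>\<^sup>+x. f x \<partial>lborel) = (\<integral>\<^sup>+x. f x \<partial>density (distr lborel borel T) (\<lambda>_. (\<Prod>j\<in>Basis. \<bar>c \<bullet> j\<bar>)))"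
    by simp
  also have "\<dots> = ennreal (\<Prod>j\<in>Basis. \<bar>c \<bullet> j\<bar>) * (\<integral>\<^sup>+x. f (T x) \<partial>lborel)"
    by (subst nn_integral_density) (auto simp: nn_integral_distr nn_integral_cmult)
  finally show ?thesis by (simp add: T)
qed

lemma gas_box_eq_cbox: "gas_box l = cbox 0 l"
  by (auto simp: gas_box_def mem_box_cart)

lemma fold_map_borel [measurable]: "fold_map l \<in> borel_measurable borel"
  unfolding fold_map_def by (intro borel_measurable_vec_lambda) measurable

text \<open>On every sheet the folding map inverts an affine map with slopes
  \<open>pi / l $ s\<close> up to sign, so all sheets contribute the same multiple of the integral
  over the box; there is one sheet per subset of the coordinates.\<close>

lemma nn_integral_torus_fold_map:
  fixes g :: "real ^ 'n \<Rightarrow> ennreal"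
  assumes g[measurable]: "g \<in> borel_measurable borel" and l: "\<And>s. 0 < l $ s"
  shows "(\<integral>\<^sup>+x. g (fold_map l x) \<partial>torus_measure)
    = ennreal (2 ^ CARD('n) * (\<Prod>j\<in>Basis. \<bar>(\<chi> s. pi / l $ s) \<bullet> j\<bar>))
      * (\<integral>\<^sup>+z. g z * indicator (gas_box l) z \<partial>lborel)"
proof -
  \<comment> \<open>\<open>P S\<close> is the sheet of the covering on which exactly the coordinates in \<open>S\<close> are reflected.\<close>
  define P :: "'n set \<Rightarrow> (real ^ 'n) set" where
    "P S = torus \<inter> (\<Inter>s. if s \<in> S then {x. pi < x $ s} else {x. x $ s \<le> pi})" for S
  have Pmeas[measurable]: "P S \<in> sets borel" for S
  proof -
    have "(if s \<in> S then {x :: real ^ 'n. pi < x $ s} else {x. x $ s \<le> pi}) \<in> sets borel" for s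
      by (cases "s \<in> S")
        (simp_all add: borel_open borel_closed open_Collect_less closed_Collect_le continuous_intros)
    then show ?thesis
      unfolding P_def by (intro sets.Int torus_borel sets.countable_INT) (auto simp: countable_finite)
  qed
  have part: "(\<Sum>S\<in>UNIV. indicator (P S) x) = (indicator torus x :: ennreal)" for x
  proof -
    \<comment> \<open>A point of the cube determines its sheet: \<open>S\<close> must be the set of
      coordinates exceeding \<open>pi\<close>.\<close>
    have "x \<in> P S \<longleftrightarrow> x \<in> torus \<and> S = {s. pi < x $ s}" for S
      unfolding P_def by (auto split: if_splits simp: not_less)
    then have "indicator (P S) x = (if S = {s. pi < x $ s} then indicator torus x else 0 :: ennreal)" for S
      by (auto simp: indicator_def)
    then show ?thesis by simp
  qed
  let ?\<Pi> = "\<Prod>j\<in>Basis. \<bar>(\<chi> s. pi / l $ s) \<bullet> j\<bar>"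
  have piece: "(\<integral>\<^sup>+x. g (fold_map l x) * indicator (P S) x \<partial>lborel)
      = ennreal ?\<Pi> * (\<integral>\<^sup>+z. g z * indicator (gas_box l) z \<partial>lborel)" for S
  proof -
    \<comment> \<open>\<open>T\<close> inverts the folding map on the sheet \<open>P S\<close>: a
      reflected coordinate is \<open>2 * pi - pi * z / l\<close>, any other is
      \<open>pi * z / l\<close>.\<close>
    define c :: "real ^ 'n" where "c = (\<chi> s. if s \<in> S then - (pi / l $ s) else pi / l $ s)"
    define t :: "real ^ 'n" where "t = (\<chi> s. if s \<in> S then 2 * pi else 0)"
    define T :: "real ^ 'n \<Rightarrow> real ^ 'n" where "T z = (\<chi> s. t $ s + c $ s * z $ s)" for z
    have cnz: "c $ s \<noteq> 0" for s using l[of s] by (simp add: c_def)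
    have cprod: "(\<Prod>j\<in>Basis. \<bar>c \<bullet> j\<bar>) = ?\<Pi>"
      by (intro prod.cong) (auto simp: c_def Basis_vec_def inner_axis)
    have fold: "fold_map l (T z) = z" if "T z \<in> P S" for z
    proof -
      have "fold_map l (T z) $ s = z $ s" for s
      proof (cases "s \<in> S")
        case True
        then have "pi < T z $ s" using that by (auto simp: P_def split: if_splits)
        then show ?thesis using True l[of s] by (simp add: fold_map_def T_def c_def t_def)
      next
        case False
        then have "T z $ s \<le> pi" using that by (auto simp: P_def split: if_splits)
        then show ?thesis using False l[of s] by (simp add: fold_map_def T_def c_def t_def)
      qed
      then show ?thesis by (simp add: vec_eq_iff)
    qed
    \<comment> \<open>The sheets are half open, so \<open>T\<close> may miss \<open>P S\<close> for
      points on the walls of the box; these form a null set and are excluded.\<close>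
    have "T z \<in> P S \<longleftrightarrow> z \<in> gas_box l" if z: "z \<notin> frontier (cbox 0 l)" for z
    proof
      assume *: "T z \<in> P S"
      have "0 \<le> z $ s \<and> z $ s \<le> l $ s" for s
      proof (cases "s \<in> S")
        case True
        then have "pi < T z $ s" "T z $ s < 2 * pi" using * by (auto simp: P_def torus_def split: if_splits)
        then show ?thesis using True l[of s] by (simp add: T_def c_def t_def field_simps zero_less_mult_iff)
      next
        case False
        then have "T z $ s \<le> pi" "0 \<le> T z $ s" using * by (auto simp: P_def torus_def split: if_splits)
        then show ?thesis using False l[of s] pi_gt_zero by (auto simp: T_def c_def t_def field_simps zero_le_mult_iff)
      qed
      then show "z \<in> gas_box l" by (simp add: gas_box_def)
    next
      assume "z \<in> gas_box l"
      then have "z \<in> box 0 l"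
        using z by (simp add: gas_box_eq_cbox frontier_cbox)
      then have zs: "0 < z $ s" "z $ s < l $ s" for s by (auto simp: mem_box_cart)
      have "0 \<le> T z $ s \<and> T z $ s < 2 * pi \<and> (if s \<in> S then pi < T z $ s else T z $ s \<le> pi)" for s
        using zs[of s] l[of s] by (simp add: T_def c_def t_def field_simps)
      then show "T z \<in> P S" by (auto simp: P_def torus_def)
    qed
    then have box: "indicator (P S) (T z) = (indicator (gas_box l) z :: ennreal)"
      if "z \<notin> frontier (cbox 0 l)" for z using that by (simp add: indicator_def)
    have "frontier (cbox 0 l) \<in> null_sets lborel"
      using negligible_frontier_interval(1)[of 0 l]
      by (simp add: frontier_cbox negligible_iff_null_sets null_sets_completion_iff)
    then have AE: "AE z in lborel. z \<notin> frontier (cbox 0 l)" by (rule AE_not_in)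
    have "(\<integral>\<^sup>+x. g (fold_map l x) * indicator (P S) x \<partial>lborel)
        = ennreal ?\<Pi> * (\<integral>\<^sup>+z. g (fold_map l (T z)) * indicator (P S) (T z) \<partial>lborel)"
      unfolding T_def cprod[symmetric]
      by (intro nn_integral_lborel_affine_cart cnz) measurable
    also have "(\<integral>\<^sup>+z. g (fold_map l (T z)) * indicator (P S) (T z) \<partial>lborel)
        = (\<integral>\<^sup>+z. g z * indicator (gas_box l) z \<partial>lborel)"
      using AE
      by (intro nn_integral_cong_AE, eventually_elim)
         (metis box fold indicator_simps(2) mult_zero_right)
    finally show ?thesis .
  qed
  have "(\<integral>\<^sup>+x. g (fold_map l x) \<partial>torus_measure)
      = (\<integral>\<^sup>+x. (\<Sum>S\<in>UNIV. g (fold_map l x) * indicator (P S) x) \<partial>lborel)"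
    by (simp add: nn_integral_torus_measure part flip: sum_distrib_left)
  also have "\<dots> = (\<Sum>S\<in>(UNIV :: 'n set set). ennreal ?\<Pi> * (\<integral>\<^sup>+z. g z * indicator (gas_box l) z \<partial>lborel))"
    by (subst nn_integral_sum) (auto simp: piece)
  also have "\<dots> = ennreal (2 ^ CARD('n) * ?\<Pi>) * (\<integral>\<^sup>+z. g z * indicator (gas_box l) z \<partial>lborel)"
    by (simp add: card_UNIV_set ennreal_mult prod_nonneg mult.assoc flip: ennreal_power)
  finally show ?thesis .
qed

section \<open>The gas flow\<close>

definition gas_measure :: "((real ^ 'n) \<times> (real ^ 'n)) measure" where
  "gas_measure = lborel \<Otimes>\<^sub>M torus_measure"

text \<open>The flow run backwards for time \<open>t\<close>, followed by a rotation of the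
  positions by \<open>a\<close>. Composing the initial density with \<open>gas_flow t 0\<close>
  gives the density at time \<open>t\<close>; \<open>a\<close> is the parameter to be
  averaged.\<close>

definition gas_flow :: "real \<Rightarrow> real ^ 'n \<Rightarrow> (real ^ 'n) \<times> (real ^ 'n) \<Rightarrow> (real ^ 'n) \<times> (real ^ 'n)" where
  "gas_flow t a p = (fst p, torus_class (snd p - t *\<^sub>R fst p + a))"

lemma pair_sigma_finite_gas: "pair_sigma_finite lborel (torus_measure :: (real ^ 'n) measure)"
proof -
  interpret finite_measure "torus_measure :: (real ^ 'n) measure" by (rule finite_measure_torus)
  show ?thesis by unfold_locales
qed

lemma borel_measurable_gas_measure:
  "f \<in> borel \<rightarrow>\<^sub>M N \<Longrightarrow> f \<in> gas_measure \<rightarrow>\<^sub>M N"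
proof (rule measurable_compose[of "\<lambda>p. p" _ borel])
  have "(\<lambda>p. (fst p, snd p)) \<in> gas_measure \<rightarrow>\<^sub>M borel"
    unfolding gas_measure_def
    by (intro borel_measurable_Pair measurable_compose[OF measurable_fst] measurable_compose[OF measurable_snd]
        borel_measurable_torus_measure) simp_all
  then show "(\<lambda>p. p) \<in> gas_measure \<rightarrow>\<^sub>M borel" by simp
qed

lemma gas_flow_borel: "gas_flow t a \<in> borel_measurable borel"
  unfolding gas_flow_def[abs_def] borel_prod[symmetric] by measurable

text \<open>Both orders serve: positions innermost for the flow, velocities innermost for
  boosts.\<close>

lemma nn_integral_gas_measure_iterated:
  assumes "F \<in> borel_measurable borel"
  shows "(\<integral>\<^sup>+p. F p \<partial>gas_measure) = (\<integral>\<^sup>+\<omega>. \<integral>\<^sup>+x. F (\<omega>, x) \<partial>torus_measure \<partial>lborel)"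
    and "(\<integral>\<^sup>+p. F p \<partial>gas_measure) = (\<integral>\<^sup>+x. \<integral>\<^sup>+\<omega>. F (\<omega>, x) \<partial>lborel \<partial>torus_measure)"
proof -
  interpret pair_sigma_finite lborel "torus_measure :: (real ^ 'a) measure" by (rule pair_sigma_finite_gas)
  have F: "F \<in> borel_measurable (lborel \<Otimes>\<^sub>M torus_measure)"
    using borel_measurable_gas_measure[OF assms] by (simp add: gas_measure_def)
  show "(\<integral>\<^sup>+p. F p \<partial>gas_measure) = (\<integral>\<^sup>+\<omega>. \<integral>\<^sup>+x. F (\<omega>, x) \<partial>torus_measure \<partial>lborel)"
    unfolding gas_measure_def by (rule M2.nn_integral_fst[OF F, symmetric])
  show "(\<integral>\<^sup>+p. F p \<partial>gas_measure) = (\<integral>\<^sup>+x. \<integral>\<^sup>+\<omega>. F (\<omega>, x) \<partial>lborel \<partial>torus_measure)"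
    unfolding gas_measure_def by (rule nn_integral_snd[symmetric]) (use F in simp)
qed

text \<open>Turns phase space integrals into integrals over the whole Euclidean space, where
  continuity of translation is available.\<close>

lemma nn_integral_gas_measure:
  assumes [measurable]: "F \<in> borel_measurable borel"
  shows "(\<integral>\<^sup>+p. F p \<partial>gas_measure) = (\<integral>\<^sup>+p. F p * indicator (UNIV \<times> torus) p \<partial>lborel)"
proof -
  have [measurable]: "F \<in> borel_measurable (borel \<Otimes>\<^sub>M borel)" by (simp add: borel_prod)
  have "(\<integral>\<^sup>+p. F p \<partial>gas_measure) = (\<integral>\<^sup>+\<omega>. \<integral>\<^sup>+x. F (\<omega>, x) * indicator (UNIV \<times> torus) (\<omega>, x) \<partial>lborel \<partial>lborel)"
    by (subst nn_integral_gas_measure_iterated(1)[OF assms])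
       (simp add: nn_integral_torus_measure indicator_times)
  also have "\<dots> = (\<integral>\<^sup>+p. F p * indicator (UNIV \<times> torus) p \<partial>(lborel \<Otimes>\<^sub>M lborel))"
    by (rule lborel.nn_integral_fst) measurable
  finally show ?thesis by (simp add: lborel_prod)
qed

text \<open>At fixed velocity the flow is a rotation of the torus by
  \<open>a - t *\<^sub>R \<omega>\<close>.\<close>

lemma nn_integral_gas_flow:
  assumes F: "F \<in> borel_measurable borel"
  shows "(\<integral>\<^sup>+p. F (gas_flow t a p) \<partial>gas_measure) = (\<integral>\<^sup>+p. F p \<partial>gas_measure)"
proof -
  have F\<omega>: "(\<lambda>x. F (\<omega>, x)) \<in> borel_measurable borel" for \<omega>
    using F by (rule measurable_compose[rotated]) simp
  have "(\<integral>\<^sup>+p. F (gas_flow t a p) \<partial>gas_measure)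
      = (\<integral>\<^sup>+\<omega>. \<integral>\<^sup>+x. F (\<omega>, torus_class (x + (a - t *\<^sub>R \<omega>))) \<partial>torus_measure \<partial>lborel)"
    using nn_integral_gas_measure_iterated(1)[OF measurable_compose[OF gas_flow_borel F]]
    by (simp add: gas_flow_def algebra_simps)
  also have "\<dots> = (\<integral>\<^sup>+p. F p \<partial>gas_measure)"
    by (simp add: nn_integral_torus_rotation[OF F\<omega>] nn_integral_gas_measure_iterated(1)[OF F])
  finally show ?thesis .
qed

text \<open>At fixed position a boost is a translation of velocity space.\<close>

lemma nn_integral_gas_boost:
  assumes F: "F \<in> borel_measurable borel"
  shows "(\<integral>\<^sup>+p. F (p + (b, 0)) \<partial>gas_measure) = (\<integral>\<^sup>+p. F p \<partial>gas_measure)"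
proof -
  have "(\<lambda>p. F (p + (b, 0))) \<in> borel_measurable borel"
    using F by (rule measurable_compose[rotated]) simp
  moreover have "(\<lambda>\<omega>. F (\<omega>, x)) \<in> borel_measurable borel" for x
    using F by (rule measurable_compose[rotated]) simp
  ultimately show ?thesis
    using lborel_nn_integral_translate[of "\<lambda>\<omega>. F (\<omega>, x)" b for x]
    by (simp add: nn_integral_gas_measure_iterated(2) F)
qed

text \<open>Indicators \<open>h\<close> show that \<open>X\<close> and \<open>Y\<close> have the
  same distribution. This carries invariance from nonnegative integrals over to real integrands and
  to integrability.\<close>

lemma
  fixes F :: "'b \<Rightarrow> real"
  assumes X: "X \<in> M \<rightarrow>\<^sub>M N" and Y: "Y \<in> M \<rightarrow>\<^sub>M N"
    and eq: "\<And>h. h \<in> borel_measurable N \<Longrightarrow> (\<integral>\<^sup>+p. h (X p) \<partial>M) = (\<integral>\<^sup>+p. h (Y p) \<partial>M)"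
    and F: "F \<in> borel_measurable N"
  shows integral_cong_nn_integral: "(LINT p|M. F (X p)) = (LINT p|M. F (Y p))"
    and integrable_cong_nn_integral: "integrable M (\<lambda>p. F (X p)) \<longleftrightarrow> integrable M (\<lambda>p. F (Y p))"
proof -
  have "distr M N X = distr M N Y"
  proof (rule measure_eqI)
    fix A assume "A \<in> sets (distr M N X)"
    then have A[measurable]: "A \<in> sets N" by simp
    have "emeasure (distr M N X) A = (\<integral>\<^sup>+p. indicator A (X p) \<partial>M)"
      using X A by (simp add: nn_integral_distr flip: nn_integral_indicator)
    also have "\<dots> = (\<integral>\<^sup>+p. indicator A (Y p) \<partial>M)" by (rule eq) simp
    also have "\<dots> = emeasure (distr M N Y) A"
      using Y A by (simp add: nn_integral_distr flip: nn_integral_indicator)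
    finally show "emeasure (distr M N X) A = emeasure (distr M N Y) A" .
  qed simp
  then show "(LINT p|M. F (X p)) = (LINT p|M. F (Y p))"
    "integrable M (\<lambda>p. F (X p)) \<longleftrightarrow> integrable M (\<lambda>p. F (Y p))"
    using integral_distr[OF X F] integral_distr[OF Y F]
      integrable_distr_eq[OF X F] integrable_distr_eq[OF Y F] by simp_all
qed

lemma gas_ident: "(\<lambda>p. p) \<in> gas_measure \<rightarrow>\<^sub>M borel"
  by (rule borel_measurable_gas_measure) simp

lemma
  fixes F :: "(real ^ 'n) \<times> (real ^ 'n) \<Rightarrow> real"
  assumes "F \<in> borel_measurable borel"
  shows integral_gas_flow: "(LINT p|gas_measure. F (gas_flow t a p)) = (LINT p|gas_measure. F p)"
    and integrable_gas_flow: "integrable gas_measure (\<lambda>p. F (gas_flow t a p)) \<longleftrightarrow> integrable gas_measure F"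
    and integral_gas_boost: "(LINT p|gas_measure. F (p + (b, 0))) = (LINT p|gas_measure. F p)"
    and integrable_gas_boost: "integrable gas_measure (\<lambda>p. F (p + (b, 0))) \<longleftrightarrow> integrable gas_measure F"
proof -
  have fl: "gas_flow t a \<in> gas_measure \<rightarrow>\<^sub>M borel"
    by (rule borel_measurable_gas_measure) (rule gas_flow_borel)
  have bo: "(\<lambda>p. p + (b, 0)) \<in> gas_measure \<rightarrow>\<^sub>M borel"
    by (rule borel_measurable_gas_measure) simp
  show "(LINT p|gas_measure. F (gas_flow t a p)) = (LINT p|gas_measure. F p)"
    by (rule integral_cong_nn_integral[OF fl gas_ident _ assms]) (rule nn_integral_gas_flow)
  show "integrable gas_measure (\<lambda>p. F (gas_flow t a p)) \<longleftrightarrow> integrable gas_measure F"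
    by (rule integrable_cong_nn_integral[OF fl gas_ident _ assms]) (rule nn_integral_gas_flow)
  show "(LINT p|gas_measure. F (p + (b, 0))) = (LINT p|gas_measure. F p)"
    by (rule integral_cong_nn_integral[OF bo gas_ident _ assms]) (rule nn_integral_gas_boost)
  show "integrable gas_measure (\<lambda>p. F (p + (b, 0))) \<longleftrightarrow> integrable gas_measure F"
    by (rule integrable_cong_nn_integral[OF bo gas_ident _ assms]) (rule nn_integral_gas_boost)
qed

lemma
  fixes F :: "(real ^ 'n) \<times> (real ^ 'n) \<Rightarrow> real"
  assumes F: "F \<in> borel_measurable borel"
  shows integral_abs_gas_measure:
      "(LINT p|gas_measure. \<bar>F p\<bar>) = (LINT p|lborel. \<bar>indicator (UNIV \<times> torus) p * F p\<bar>)"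
    and integrable_gas_measure_iff:
      "integrable gas_measure F \<longleftrightarrow> integrable lborel (\<lambda>p. indicator (UNIV \<times> torus) p * F p)"
proof -
  have FQ: "F \<in> borel_measurable gas_measure" by (rule borel_measurable_gas_measure[OF F])
  have [measurable]: "UNIV \<times> torus \<in> sets (borel :: ((real ^ 'n) \<times> (real ^ 'n)) measure)"
    unfolding borel_prod[symmetric] by measurable
  have FI: "(\<lambda>p. indicator (UNIV \<times> torus) p * F p) \<in> borel_measurable borel"
    using F by measurable
  have "(\<integral>\<^sup>+p. ennreal \<bar>F p\<bar> \<partial>gas_measure) = (\<integral>\<^sup>+p. ennreal \<bar>F p\<bar> * indicator (UNIV \<times> torus) p \<partial>lborel)"
    by (rule nn_integral_gas_measure) (use F in measurable)
  also have "\<dots> = (\<integral>\<^sup>+p. ennreal \<bar>indicator (UNIV \<times> torus) p * F p\<bar> \<partial>lborel)"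
    by (intro nn_integral_cong) (simp split: split_indicator)
  finally have eq: "(\<integral>\<^sup>+p. ennreal \<bar>F p\<bar> \<partial>gas_measure) = (\<integral>\<^sup>+p. ennreal \<bar>indicator (UNIV \<times> torus) p * F p\<bar> \<partial>lborel)" .
  show "(LINT p|gas_measure. \<bar>F p\<bar>) = (LINT p|lborel. \<bar>indicator (UNIV \<times> torus) p * F p\<bar>)"
    using FQ FI eq by (subst (1 2) integral_eq_nn_integral) auto
  show "integrable gas_measure F \<longleftrightarrow> integrable lborel (\<lambda>p. indicator (UNIV \<times> torus) p * F p)"
    unfolding integrable_iff_bounded using FQ FI eq by simp
qed

section \<open>Equidistribution\<close>

text \<open>A boost changes velocities only, so it commutes with cutting off to
  \<open>UNIV \<times> torus\<close>; continuity of translation applies to the extension by zero,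
  with shifts \<open>(b, 0)\<close>.\<close>

lemma gas_boost_continuous_L1:
  fixes g :: "(real ^ 'n) \<times> (real ^ 'n) \<Rightarrow> real"
  assumes g: "g \<in> borel_measurable borel" "integrable gas_measure g" and "0 < e"
  obtains d where "0 < d" "\<And>b. norm b < d \<Longrightarrow> (LINT p|gas_measure. \<bar>g (p + (b, 0)) - g p\<bar>) < e"
proof -
  define h where "h p = indicator (UNIV \<times> torus) p * g p" for p :: "(real ^ 'n) \<times> (real ^ 'n)"
  have "integrable lborel h"
    using g integrable_gas_measure_iff[OF g(1)] by (simp add: h_def[abs_def])
  then have "((\<lambda>q. LINT p|lborel. \<bar>h (p + q) - h p\<bar>) \<longlongrightarrow> 0) (at 0)"
    by (rule continuity_of_translation_L1)
  from tendstoD[OF this \<open>0 < e\<close>] obtain d where d: "0 < d"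
    "\<And>q. q \<noteq> 0 \<Longrightarrow> dist q 0 < d \<Longrightarrow> dist (LINT p|lborel. \<bar>h (p + q) - h p\<bar>) 0 < e"
    by (auto simp: eventually_at)
  have "(LINT p|gas_measure. \<bar>g (p + (b, 0)) - g p\<bar>) < e" if b: "norm b < d" for b
  \<comment> \<open>The limit at 0 says nothing about the zero shift, for which the integrand
    vanishes.\<close>
  proof (cases "b = 0")
    case True
    then show ?thesis using \<open>0 < e\<close> by (simp add: zero_prod_def[symmetric])
  next
    case False
    have "(\<lambda>p. g (p + (b, 0)) - g p) \<in> borel_measurable borel"
      using g(1) by measurable
    then have "(LINT p|gas_measure. \<bar>g (p + (b, 0)) - g p\<bar>)
        = (LINT p|lborel. \<bar>indicator (UNIV \<times> torus) p * (g (p + (b, 0)) - g p)\<bar>)"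
      by (rule integral_abs_gas_measure)
    also have "\<dots> = (LINT p|lborel. \<bar>h (p + (b, 0)) - h p\<bar>)"
      by (intro Bochner_Integration.integral_cong refl)
         (auto simp: h_def indicator_def mem_Times_iff algebra_simps)
    also have "\<dots> < e"
      using d(2)[of "(b, 0)"] False b by (simp add: dist_norm zero_prod_def norm_Pair)
    finally show ?thesis .
  qed
  with d(1) that show ?thesis by blast
qed

text \<open>The bound on \<open>u\<close> lets every error be measured by the L1 norm of a
  difference of densities. Only \<open>\<bar>t\<bar>\<close> enters the estimates, so both time
  directions are treated at once.\<close>

lemma gas_equidistribution:
  fixes g :: "(real ^ 'n) \<times> (real ^ 'n) \<Rightarrow> real" and u :: "real ^ 'n \<Rightarrow> real"
  assumes g[measurable]: "g \<in> borel_measurable borel" and gint: "integrable gas_measure g"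
    and u[measurable]: "u \<in> borel_measurable borel" and ub: "\<And>x. \<bar>u x\<bar> \<le> 1"
    and pos: "0 < measure (torus_measure :: (real ^ 'n) measure) torus"
  shows "((\<lambda>t. LINT p|gas_measure. g (gas_flow t 0 p) * u (snd p))
    \<longlongrightarrow> (LINT p|gas_measure. g p) * (LINT x|torus_measure. u x) / measure (torus_measure :: (real ^ 'n) measure) torus) at_infinity"
proof -
  let ?M = "torus_measure :: (real ^ 'n) measure"
  let ?Q = "gas_measure :: ((real ^ 'n) \<times> (real ^ 'n)) measure"
  define \<mu> where "\<mu> = measure ?M torus"
  have \<mu>: "0 < \<mu>" using pos by (simp add: \<mu>_def)
  define L where "L = (LINT p|?Q. g p) * (LINT x|?M. u x)"
  define K where "K t = (LINT p|?Q. g (gas_flow t 0 p) * u (snd p))" for t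
  \<comment> \<open>\<open>D t a\<close> is \<open>K t\<close> with positions rotated by
    \<open>a\<close>; in particular \<open>D t 0 = K t\<close>.\<close>
  define D where "D t a = (LINT p|?Q. g (gas_flow t a p) * u (snd p))" for t a
  interpret M: finite_measure ?M by (rule finite_measure_torus)
  interpret LM: pair_sigma_finite lborel ?M by (rule pair_sigma_finite_gas)
  interpret Q: sigma_finite_measure ?Q
    unfolding gas_measure_def by unfold_locales
  interpret MQ: pair_sigma_finite ?M ?Q ..

  have [measurable]: "fst \<in> (borel :: ((real ^ 'n) \<times> (real ^ 'n)) measure) \<rightarrow>\<^sub>M borel"
    "snd \<in> (borel :: ((real ^ 'n) \<times> (real ^ 'n)) measure) \<rightarrow>\<^sub>M borel"
    by (auto intro!: borel_measurable_continuous_onI continuous_intros)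
  have gflow: "(\<lambda>p. g (gas_flow t a p)) \<in> borel_measurable ?Q" for t a
    by (intro borel_measurable_gas_measure measurable_compose[OF gas_flow_borel] g)
  have usnd: "(\<lambda>p. u (snd p)) \<in> borel_measurable ?Q"
    by (rule borel_measurable_gas_measure) measurable
  have iflow: "integrable ?Q (\<lambda>p. g (gas_flow t a p))" for t a
    using integrable_gas_flow[OF g] gint by simp
  have bnd: "\<bar>c * u x\<bar> \<le> \<bar>c\<bar>" for c x
    using mult_left_mono[OF ub[of x], of "\<bar>c\<bar>"] by (simp add: abs_mult)
  have iu: "integrable ?Q (\<lambda>p. F p * u (snd p))" if "integrable ?Q F" for F
    by (rule Bochner_Integration.integrable_bound[OF that])
       (use bnd usnd borel_measurable_integrable[OF that] in auto)

  have close: "\<bar>K t - D t a\<bar> \<le> (LINT p|?Q. \<bar>g (p + (- (a /\<^sub>R t), 0)) - g p\<bar>)" if "t \<noteq> 0" for t a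
  proof -
    define b where "b = - (a /\<^sub>R t)"
    \<comment> \<open>The choice of \<open>b\<close> gives \<open>- t *\<^sub>R b = a\<close>, so
      the boost acts on positions at time \<open>t\<close> as the rotation by
      \<open>a\<close>.\<close>
    have comm: "gas_flow t 0 (p + (b, 0)) = gas_flow t a p + (b, 0)" for p
      using that by (cases p) (simp add: gas_flow_def b_def algebra_simps)
    have gb: "(\<lambda>p. g (p + (b, 0))) \<in> borel_measurable borel" by measurable
    have igb: "integrable ?Q (\<lambda>p. g (p + (b, 0)))"
      using integrable_gas_boost[OF g] gint by simp
    have igbf: "integrable ?Q (\<lambda>p. g (gas_flow t a p + (b, 0)))"
      using integrable_gas_flow[OF gb] igb by simp
    have gK: "(\<lambda>p. g (gas_flow t 0 p) * u (snd p)) \<in> borel_measurable borel"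
      by (intro borel_measurable_times measurable_compose[OF gas_flow_borel g]) measurable
    \<comment> \<open>Boost invariance applies because \<open>u\<close> depends on the position
      alone.\<close>
    have "K t = (LINT p|?Q. g (gas_flow t a p + (b, 0)) * u (snd p))"
      unfolding K_def using integral_gas_boost[OF gK, of b] by (simp add: comm)
    then have "K t - D t a = (LINT p|?Q. (g (gas_flow t a p + (b, 0)) - g (gas_flow t a p)) * u (snd p))"
      unfolding D_def using iu[OF igbf] iu[OF iflow[of t a]]
      by (simp add: left_diff_distrib)
    also have "\<bar>\<dots>\<bar> \<le> (LINT p|?Q. \<bar>g (gas_flow t a p + (b, 0)) - g (gas_flow t a p)\<bar>)"
    proof (rule integral_abs_bound_integral)
      show "integrable ?Q (\<lambda>p. (g (gas_flow t a p + (b, 0)) - g (gas_flow t a p)) * u (snd p))"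
        by (intro iu Bochner_Integration.integrable_diff igbf iflow)
    qed (use igbf iflow bnd in auto)
    \<comment> \<open>Invariance under the flow removes \<open>gas_flow t a\<close>, leaving a bound
      that sees \<open>t\<close> and \<open>a\<close> only through \<open>b\<close>.\<close>
    also have "\<dots> = (LINT p|?Q. \<bar>g (p + (b, 0)) - g p\<bar>)"
      by (rule integral_gas_flow[where F = "\<lambda>p. \<bar>g (p + (b, 0)) - g p\<bar>"]) (use gb in measurable)
    finally show ?thesis by (simp add: b_def)
  qed

  \<comment> \<open>By flow invariance the inner integral of the norm is at most the L1 norm of
    \<open>g\<close>, uniformly in \<open>a\<close>, and the torus has finite measure.\<close>
  have int: "integrable (?M \<Otimes>\<^sub>M ?Q) (\<lambda>(a, p). g (gas_flow t a p) * u (snd p))" for t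
  proof (rule MQ.Fubini_integrable)
    have m1[measurable]: "(\<lambda>z. fst z) \<in> ?M \<Otimes>\<^sub>M ?Q \<rightarrow>\<^sub>M borel"
      by (rule measurable_compose[OF measurable_fst]) (intro borel_measurable_torus_measure, simp)
    have m2[measurable]: "(\<lambda>z. snd z) \<in> ?M \<Otimes>\<^sub>M ?Q \<rightarrow>\<^sub>M borel"
      by (rule measurable_compose[OF measurable_snd gas_ident])
    have [measurable]: "(\<lambda>z. fst (snd z)) \<in> ?M \<Otimes>\<^sub>M ?Q \<rightarrow>\<^sub>M borel" "(\<lambda>z. snd (snd z)) \<in> ?M \<Otimes>\<^sub>M ?Q \<rightarrow>\<^sub>M borel"
      by (rule measurable_compose[OF m2], simp)+
    have "(\<lambda>z. gas_flow t (fst z) (snd z)) \<in> ?M \<Otimes>\<^sub>M ?Q \<rightarrow>\<^sub>M borel"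
      unfolding gas_flow_def by (intro borel_measurable_Pair measurable_compose[OF _ torus_class_borel]) measurable
    from measurable_compose[OF this g]
    show meas: "(\<lambda>(a, p). g (gas_flow t a p) * u (snd p)) \<in> borel_measurable (?M \<Otimes>\<^sub>M ?Q)"
      by (simp add: case_prod_beta)
    have "(LINT p|?Q. norm (g (gas_flow t a p) * u (snd p))) \<le> (LINT p|?Q. \<bar>g p\<bar>)" for a
    proof -
      have "(LINT p|?Q. norm (g (gas_flow t a p) * u (snd p))) \<le> (LINT p|?Q. \<bar>g (gas_flow t a p)\<bar>)"
        using iflow[of t a] iu[OF iflow[of t a]] by (intro integral_mono) (auto simp: bnd)
      also have "\<dots> = (LINT p|?Q. \<bar>g p\<bar>)"
        by (rule integral_gas_flow) measurable
      finally show ?thesis .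
    qed
    moreover have "(\<lambda>a. LINT p|?Q. norm (case (a, p) of (a, p) \<Rightarrow> g (gas_flow t a p) * u (snd p))) \<in> borel_measurable ?M"
      using meas by (intro Q.borel_measurable_lebesgue_integral) (simp add: case_prod_beta)
    ultimately show "integrable ?M (\<lambda>a. LINT p|?Q. norm (case (a, p) of (a, p) \<Rightarrow> g (gas_flow t a p) * u (snd p)))"
      by (intro M.integrable_const_bound[where B = "LINT p|?Q. \<bar>g p\<bar>"]) auto
    show "AE a in ?M. integrable ?Q (\<lambda>p. case (a, p) of (a, p) \<Rightarrow> g (gas_flow t a p) * u (snd p))"
      using iu[OF iflow] by simp
  qed
  \<comment> \<open>As \<open>a\<close> runs over the torus so does the rotated position; the
    average forgets both \<open>t\<close> and the initial position.\<close>
  have inner: "(LINT a|?M. g (gas_flow t a p)) = (LINT x|?M. g (fst p, x))" for t p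
  proof -
    have gp: "(\<lambda>x. g (fst p, x)) \<in> borel_measurable borel" by measurable
    let ?X = "\<lambda>a. torus_class (a + (snd p - t *\<^sub>R fst p))"
    have "(LINT a|?M. g (fst p, ?X a)) = (LINT x|?M. g (fst p, x))"
      by (rule integral_cong_nn_integral[where N = borel, OF _ _ _ gp])
         (auto intro!: borel_measurable_torus_measure nn_integral_torus_rotation)
    then show ?thesis
      by (simp add: gas_flow_def add.commute)
  qed
  \<comment> \<open>After averaging over \<open>a\<close>, the density depends on the velocity only,
    so the position integral of \<open>u\<close> factors out.\<close>
  have avg: "(LINT a|?M. D t a) = L" for t
  proof -
    have "(LINT a|?M. D t a) = (LINT p|?Q. LINT a|?M. g (gas_flow t a p) * u (snd p))"
      unfolding D_def using MQ.Fubini_integral[OF int] by simp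
    also have "\<dots> = (LINT p|?Q. (LINT x|?M. g (fst p, x)) * u (snd p))"
      by (simp add: inner)
    also have "\<dots> = (LINT \<omega>|lborel. LINT y|?M. (LINT x|?M. g (\<omega>, x)) * u y)"
      using LM.integral_fst'[of "\<lambda>p. (LINT x|?M. g (fst p, x)) * u (snd p)"] MQ.integrable_snd[OF int, of t]
      by (simp add: inner gas_measure_def)
    also have "\<dots> = (LINT \<omega>|lborel. LINT x|?M. g (\<omega>, x)) * (LINT y|?M. u y)"
      by simp
    also have "\<dots> = L"
      using LM.integral_fst'[of g] gint by (simp add: L_def gas_measure_def)
    finally show ?thesis .
  qed
  have "(K \<longlongrightarrow> L / \<mu>) at_infinity"
  proof (rule tendstoI)
    fix e :: real assume "0 < e"
    then have e2: "0 < e / 2" by simp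
    obtain d where d: "0 < d" "\<And>b. norm b < d \<Longrightarrow> (LINT p|?Q. \<bar>g (p + (b, 0)) - g p\<bar>) < e/2"
      using gas_boost_continuous_L1[OF g gint e2] by blast
    \<comment> \<open>The representatives \<open>a\<close> are bounded by \<open>R\<close>, so
      \<open>\<bar>t\<bar> > R / d\<close> makes every boost \<open>a / t\<close> shorter than
      \<open>d\<close>. The extra 1 in the threshold below makes this inequality strict.\<close>
    obtain R where R: "\<And>a :: real ^ 'n. a \<in> torus \<Longrightarrow> norm a \<le> R" "0 < R"
      using bounded_subset[OF bounded_cbox torus_subset_cbox] by (auto simp: bounded_pos)
    show "\<forall>\<^sub>F t in at_infinity. dist (K t) (L / \<mu>) < e"
      unfolding eventually_at_infinity
    proof (intro exI[of _ "R / d + 1"] allI impI)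
      fix t :: real assume "R / d + 1 \<le> norm t"
      moreover have "0 < R / d" using \<open>0 < R\<close> d(1) by simp
      ultimately have t: "t \<noteq> 0" "R / d < \<bar>t\<bar>" by auto
      have KD: "\<bar>K t - D t a\<bar> \<le> e/2" if "a \<in> torus" for a
      proof -
        have "norm (- (a /\<^sub>R t)) = norm a / \<bar>t\<bar>" by (simp add: divide_inverse mult.commute)
        also have "\<dots> \<le> R / \<bar>t\<bar>" using R(1)[OF that] by (intro divide_right_mono) auto
        also have "\<dots> < d" using t d(1) by (simp add: field_simps)
        finally show ?thesis using close[OF t(1), of a] d(2) by fastforce
      qed
      have iD: "integrable ?M (D t)"
        using MQ.integrable_fst'[OF int] by (simp add: D_def[abs_def])
      \<comment> \<open>\<open>K t\<close> is constant in \<open>a\<close> and \<open>D t\<close>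
        has integral \<open>L\<close>, so the difference is an integral of uniformly small
        terms.\<close>
      have "\<mu> * K t - L = (LINT a|?M. K t - D t a)"
        using iD by (simp add: avg \<mu>_def mult.commute)
      also have "\<bar>\<dots>\<bar> \<le> (LINT a|?M. e/2)"
        by (rule integral_abs_bound_integral) (use iD KD in auto)
      also have "\<dots> = \<mu> * (e/2)" by (simp add: \<mu>_def)
      finally have "\<bar>K t - L / \<mu>\<bar> \<le> e/2"
        using \<mu> by (simp add: abs_le_iff field_simps)
      then show "dist (K t) (L / \<mu>) < e" using \<open>0 < e\<close> by (simp add: dist_real_def)
    qed
  qed
  then show ?thesis by (simp add: K_def[abs_def] L_def \<mu>_def)
qed

section \<open>Lebesgue measurable densities\<close>

text \<open>Completeness of Lebesgue measure makes \<open>f\<close> measurable from its agreement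
  with \<open>h\<close> almost everywhere.\<close>

lemma integral_lebesgue_eq_lborel_AE:
  fixes f h :: "'a::euclidean_space \<Rightarrow> real"
  assumes h: "h \<in> borel_measurable borel" and eq: "AE x in lborel. f x = h x"
  shows "integral\<^sup>L lebesgue f = integral\<^sup>L lborel h"
proof -
  have hl: "h \<in> borel_measurable lebesgue"
    using h by (simp add: measurable_completion)
  have ae: "AE x in lebesgue. f x = h x" using eq by (rule AE_completion)
  then have "AE x in lebesgue. h x = f x" by eventually_elim simp
  with hl have "f \<in> borel_measurable lebesgue" by (rule borel_measurable_AE)
  then have "integral\<^sup>L lebesgue f = integral\<^sup>L lebesgue h"
    using hl ae by (rule integral_cong_AE)
  also have "\<dots> = integral\<^sup>L lborel h"
    using h by (intro integral_completion) simp
  finally show ?thesis .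
qed

lemma AE_torus_iff: "(AE x in torus_measure. P x) \<longleftrightarrow> (AE x in lborel. x \<in> torus \<longrightarrow> P x)"
  unfolding torus_measure_def by (rule AE_restrict_space_iff) simp

lemma AE_vimage_null:
  assumes X: "X \<in> M \<rightarrow>\<^sub>M borel" and N: "N \<in> sets borel"
    and "(\<integral>\<^sup>+x. indicator N (X x) \<partial>M) = 0"
  shows "AE x in M. X x \<notin> N"
proof -
  have "(\<lambda>x. indicator N (X x) :: ennreal) \<in> borel_measurable M"
    by (rule measurable_compose[OF X]) (use N in simp)
  then have "AE x in M. indicator N (X x) = (0 :: ennreal)"
    using assms(3) by (simp add: nn_integral_0_iff_AE)
  then show ?thesis by eventually_elim (simp add: indicator_eq_0_iff)
qed

text \<open>The exceptional set is first covered by a Borel null set \<open>N\<close>; rotation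
  invariance then makes the preimage of \<open>N\<close> null.\<close>

lemma AE_torus_rotation:
  assumes "AE x in torus_measure. P x"
  shows "AE x in torus_measure. P (torus_class (x + c))"
proof -
  obtain N where N: "N \<in> null_sets lborel" "{x. \<not> (x \<in> torus \<longrightarrow> P x)} \<subseteq> N"
    using assms unfolding AE_torus_iff by (auto elim!: AE_E simp: null_sets_def)
  then have Nb: "N \<in> sets borel" by auto
  have "(\<integral>\<^sup>+x. indicator N (torus_class (x + c)) \<partial>torus_measure) = (\<integral>\<^sup>+x. indicator N x \<partial>torus_measure)"
    using Nb by (intro nn_integral_torus_rotation) simp
  also have "\<dots> \<le> (\<integral>\<^sup>+x. indicator N x \<partial>lborel)"
    unfolding nn_integral_torus_measure by (intro nn_integral_mono) (simp split: split_indicator)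
  also have "\<dots> = 0" using N(1) Nb by (simp add: null_sets_def)
  finally have "AE x in torus_measure. torus_class (x + c) \<notin> N"
    using Nb by (intro AE_vimage_null borel_measurable_torus_measure) auto
  then show ?thesis
    by eventually_elim (use N(2) torus_class_in_torus in blast)
qed

text \<open>The integral formula for the folding map bounds the measure of the preimage by a
  multiple of that of \<open>N\<close>. It serves to discard points folded into the frontier of
  \<open>G\<close>.\<close>

lemma AE_torus_fold_map:
  fixes l :: "real ^ 'n"
  assumes N: "N \<in> null_sets lborel" and l: "\<And>s. 0 < l $ s"
  shows "AE x in torus_measure. fold_map l x \<notin> N"
proof -
  have Nb: "N \<in> sets borel" using N by auto
  have "(\<integral>\<^sup>+z. indicator N z * indicator (gas_box l) z \<partial>lborel) \<le> (\<integral>\<^sup>+z. indicator N z \<partial>lborel)"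
    by (intro nn_integral_mono) (simp split: split_indicator)
  also have "\<dots> = 0" using N Nb by (simp add: null_sets_def)
  finally have "(\<integral>\<^sup>+x. indicator N (fold_map l x) \<partial>torus_measure) = 0"
    using Nb by (subst nn_integral_torus_fold_map[OF _ l]) auto
  then show ?thesis
    using Nb by (intro AE_vimage_null borel_measurable_torus_measure fold_map_borel)
qed

text \<open>The constant \<open>\<kappa>\<close> relates measures in the box to measures on the
  torus. It occurs for \<open>U\<close> and for the whole box, whose preimage is the entire torus,
  and cancels in the quotient.\<close>

lemma fold_map_mean:
  fixes l :: "real ^ 'n"
  assumes l: "\<And>s. 0 < l $ s" and U: "U \<in> sets borel" "U \<subseteq> gas_box l"
  shows "0 < measure (torus_measure :: (real ^ 'n) measure) torus"
    and "(LINT x|torus_measure. indicator U (fold_map l x)) / measure (torus_measure :: (real ^ 'n) measure) torus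
      = measure lborel U / measure lborel (gas_box l)"
proof -
  define \<kappa> :: real where "\<kappa> = 2 ^ CARD('n) * (\<Prod>j\<in>Basis. \<bar>(\<chi> s. pi / l $ s) \<bullet> j\<bar>)"
  have \<kappa>: "0 < \<kappa>"
    unfolding \<kappa>_def using less_imp_neq[OF l, symmetric]
    by (intro mult_pos_pos prod_pos) (auto simp: Basis_vec_def inner_axis)
  have gas: "gas_box l \<in> sets borel" by (simp add: gas_box_eq_cbox)
  have main: "(LINT x|torus_measure. indicator A (fold_map l x)) = \<kappa> * measure lborel A"
    if A: "A \<in> sets borel" "A \<subseteq> gas_box l" for A
  proof -
    have "(\<integral>\<^sup>+x. ennreal (indicator A (fold_map l x)) \<partial>torus_measure)
        = ennreal \<kappa> * (\<integral>\<^sup>+z. indicator A z * indicator (gas_box l) z \<partial>lborel)"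
      using A(1) nn_integral_torus_fold_map[OF _ l, of "indicator A"] by (simp add: ennreal_indicator \<kappa>_def)
    also have "(\<integral>\<^sup>+z. indicator A z * indicator (gas_box l) z \<partial>lborel) = emeasure lborel A"
      using A by (simp add: Int_absorb2 flip: indicator_inter_arith)
    finally show ?thesis
      using A(1) \<kappa>
      by (subst integral_eq_nn_integral)
         (auto intro!: borel_measurable_torus_measure simp: enn2real_mult measure_def)
  qed
  have "measure (torus_measure :: (real ^ 'n) measure) torus = (LINT x|torus_measure. indicator (gas_box l) (fold_map l x))"
  proof -
    have "fold_map l x \<in> gas_box l" if "x \<in> torus" for x
      using that l by (auto simp: fold_map_def torus_def gas_box_def field_simps less_imp_le)
    then have "(LINT x|torus_measure. indicator (gas_box l) (fold_map l x)) = (LINT x|(torus_measure :: (real ^ 'n) measure). (1::real))"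
      by (intro Bochner_Integration.integral_cong) auto
    then show ?thesis by simp
  qed
  also have "\<dots> = \<kappa> * measure lborel (gas_box l)" using gas by (intro main) auto
  finally have \<mu>: "measure (torus_measure :: (real ^ 'n) measure) torus = \<kappa> * measure lborel (gas_box l)" .
  have "0 < measure lborel (gas_box l)"
    using l by (simp add: gas_box_eq_cbox content_pos_lt_eq Basis_vec_def inner_axis)
  with \<mu> \<kappa> show "0 < measure (torus_measure :: (real ^ 'n) measure) torus" by simp
  show "(LINT x|torus_measure. indicator U (fold_map l x)) / measure (torus_measure :: (real ^ 'n) measure) torus
      = measure lborel U / measure lborel (gas_box l)"
    using main[OF U] \<mu> \<kappa> by simp
qed

text \<open>Bridge from iterated Lebesgue integrals to one Borel integral over phase space, used
  both for the total mass and for the integrand of \<open>gas_fraction\<close>.\<close>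

lemma integral_gas_iterated:
  fixes f g :: "(real ^ 'n) \<times> (real ^ 'n) \<Rightarrow> real"
  assumes g: "g \<in> borel_measurable borel" "integrable gas_measure g"
    and eq: "AE \<omega> in lborel. AE x in torus_measure. f (\<omega>, x) = g (\<omega>, x)"
  shows "(LINT \<omega>|lebesgue. (LINT x:torus|lebesgue. f (\<omega>, x))) = (LINT p|gas_measure. g p)"
proof -
  interpret pair_sigma_finite lborel "torus_measure :: (real ^ 'n) measure" by (rule pair_sigma_finite_gas)
  have g\<omega>[measurable]: "(\<lambda>x. g (\<omega>, x)) \<in> borel_measurable borel" for \<omega>
    using g(1) by (rule measurable_compose[rotated]) simp
  have gQ: "(\<lambda>(\<omega>, x). g (\<omega>, x)) \<in> borel_measurable (lborel \<Otimes>\<^sub>M torus_measure)"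
    using borel_measurable_gas_measure[OF g(1)] by (simp add: gas_measure_def)
  have inner: "(LINT x:torus|lebesgue. f (\<omega>, x)) = (LINT x|torus_measure. g (\<omega>, x))"
    if "AE x in torus_measure. f (\<omega>, x) = g (\<omega>, x)" for \<omega>
  proof -
    have "AE x in lborel. indicator torus x *\<^sub>R f (\<omega>, x) = indicator torus x *\<^sub>R g (\<omega>, x)"
      using that unfolding AE_torus_iff by eventually_elim (simp split: split_indicator)
    then have "(LINT x:torus|lebesgue. f (\<omega>, x)) = (LINT x|lborel. indicator torus x *\<^sub>R g (\<omega>, x))"
      unfolding set_lebesgue_integral_def by (intro integral_lebesgue_eq_lborel_AE) measurable
    also have "\<dots> = (LINT x|torus_measure. g (\<omega>, x))"
      unfolding torus_measure_def by (intro integral_restrict_space[symmetric]) simp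
    finally show ?thesis .
  qed
  have "(LINT \<omega>|lebesgue. (LINT x:torus|lebesgue. f (\<omega>, x))) = (LINT \<omega>|lborel. LINT x|torus_measure. g (\<omega>, x))"
  proof (rule integral_lebesgue_eq_lborel_AE)
    have "(\<lambda>\<omega>. LINT x|torus_measure. g (\<omega>, x)) \<in> borel_measurable lborel"
      by (rule M2.borel_measurable_lebesgue_integral[OF gQ])
    then show "(\<lambda>\<omega>. LINT x|torus_measure. g (\<omega>, x)) \<in> borel_measurable borel" by simp
    show "AE \<omega> in lborel. (LINT x:torus|lebesgue. f (\<omega>, x)) = (LINT x|torus_measure. g (\<omega>, x))"
      using eq by eventually_elim (rule inner)
  qed
  also have "\<dots> = (LINT p|gas_measure. g p)"
    using integral_fst'[of g] g(2) by (simp add: gas_measure_def)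
  finally show ?thesis .
qed

text \<open>A Lebesgue measurable function agrees almost everywhere with a Borel one; Fubini for
  null sets turns this into agreement on almost every velocity slice.\<close>

lemma gas_borel_representative:
  fixes f :: "(real ^ 'n) \<times> (real ^ 'n) \<Rightarrow> real"
  assumes "set_integrable lebesgue (UNIV \<times> torus) f"
  obtains g where "g \<in> borel_measurable borel" "integrable gas_measure g"
    "AE \<omega> in lborel. AE x in torus_measure. f (\<omega>, x) = g (\<omega>, x)"
proof -
  let ?I = "indicator (UNIV \<times> torus) :: (real ^ 'n) \<times> (real ^ 'n) \<Rightarrow> real"
  have int: "integrable lebesgue (\<lambda>p. ?I p * f p)"
    using assms by (simp add: set_integrable_def)
  obtain g where g: "g \<in> borel_measurable lborel" "AE p in lborel. ?I p * f p = g p"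
    using completion_ex_borel_measurable_real[OF borel_measurable_integrable[OF int]] by auto
  have gb[measurable]: "g \<in> borel_measurable borel" using g(1) by simp
  have [measurable]: "UNIV \<times> torus \<in> sets (borel :: ((real ^ 'n) \<times> (real ^ 'n)) measure)"
    unfolding borel_prod[symmetric] by measurable
  have "integrable lebesgue g"
    using int g by (subst integrable_cong_AE[where g = "\<lambda>p. ?I p * f p"])
       (auto intro: measurable_completion AE_completion elim: eventually_mono)
  then have "integrable lborel g" using g(1) by (simp add: integrable_completion)
  then have "integrable lborel (\<lambda>p. ?I p * g p)"
    by (rule Bochner_Integration.integrable_bound) (auto split: split_indicator)
  then have "integrable gas_measure g" using integrable_gas_measure_iff[OF gb] by simp
  moreover have "AE p in lborel \<Otimes>\<^sub>M lborel. ?I p * f p = g p"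
    using g(2) unfolding lborel_prod .
  then have "AE \<omega> in lborel. AE x in lborel. ?I (\<omega>, x) * f (\<omega>, x) = g (\<omega>, x)"
    by (rule lborel_pair.AE_pair)
  then have "AE \<omega> in lborel. AE x in torus_measure. f (\<omega>, x) = g (\<omega>, x)"
    unfolding AE_torus_iff
    by eventually_elim (auto elim!: eventually_mono simp: indicator_times)
  ultimately show ?thesis using that gb by blast
qed

section \<open>Limit of the gas fraction in a Jordan domain\<close>

theorem mainTheorem3:
  fixes l :: "real ^ 'n"
    and f :: "(real ^ 'n) \<times> (real ^ 'n) \<Rightarrow> real"
    and G :: "(real ^ 'n) set"
  assumes l_pos: "\<And>s. 0 < l $ s"
    and f_nonneg: "\<And>\<omega> x. x \<in> torus \<Longrightarrow> 0 \<le> f (\<omega>, x)"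
    and f_integrable: "set_integrable lebesgue (UNIV \<times> torus) f"
    and f_total: "(LINT \<omega>|lebesgue. (LINT x:torus|lebesgue. f (\<omega>, x))) = 1"
    and G_subset: "G \<subseteq> gas_box l"
    and G_jordan: "jordan_measurable G"
  shows "(gas_fraction l f G \<longlongrightarrow> measure lebesgue G / measure lebesgue (gas_box l)) at_top
       \<and> (gas_fraction l f G \<longlongrightarrow> measure lebesgue G / measure lebesgue (gas_box l)) at_bot"
proof -
  obtain g where g: "g \<in> borel_measurable borel" "integrable gas_measure g"
    and fg: "AE \<omega> in lborel. AE x in torus_measure. f (\<omega>, x) = g (\<omega>, x)"
    using gas_borel_representative[OF f_integrable] .
  have total: "(LINT p|gas_measure. g p) = 1"
    using integral_gas_iterated[OF g fg] f_total by simp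
  \<comment> \<open>The interior is open, hence Borel, and differs from \<open>G\<close> only within
    the null set \<open>frontier G\<close>.\<close>
  define U where "U = interior G"
  have U: "U \<in> sets borel" "U \<subseteq> gas_box l"
    using G_subset interior_subset[of G] by (auto simp: U_def)
  define u :: "real ^ 'n \<Rightarrow> real" where "u x = indicator U (fold_map l x)" for x
  have u: "u \<in> borel_measurable borel"
    unfolding u_def[abs_def] using U(1) by measurable
  have u1: "\<bar>u x\<bar> \<le> 1" for x by (simp add: u_def indicator_def)
  have front: "frontier G \<in> null_sets lborel"
    using G_jordan
    by (simp add: jordan_measurable_def negligible_iff_null_sets null_sets_completion_iff)
  have GU: "z \<in> G \<longleftrightarrow> z \<in> U" if "z \<notin> frontier G" for z
    using that closure_subset[of G] interior_subset[of G] by (auto simp: U_def frontier_def)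

  have frac: "gas_fraction l f G t = (LINT p|gas_measure. g (gas_flow t 0 p) * u (snd p))" for t
  proof -
    let ?F = "\<lambda>p. f (fst p, torus_class (snd p - t *\<^sub>R fst p)) * indicator G (fold_map l (snd p))"
    let ?H = "\<lambda>p. g (gas_flow t 0 p) * u (snd p)"
    have meas: "?H \<in> borel_measurable borel"
      by (intro borel_measurable_times measurable_compose[OF gas_flow_borel g(1)]
          measurable_compose[OF _ u] borel_measurable_continuous_onI continuous_intros)
    have "integrable gas_measure (\<lambda>p. g (gas_flow t 0 p))"
      using integrable_gas_flow[OF g(1)] g(2) by simp
    then have int: "integrable gas_measure ?H"
    proof (rule Bochner_Integration.integrable_bound)
      show "AE p in gas_measure. norm (?H p) \<le> norm (g (gas_flow t 0 p))"
        using mult_left_mono[OF u1] by (auto simp: abs_mult)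
    qed (rule borel_measurable_gas_measure[OF meas])
    \<comment> \<open>Two null sets of positions are discarded on each good velocity slice: those
      whose rotated position has \<open>f\<close> differ from \<open>g\<close>, and those folded
      into \<open>frontier G\<close>.\<close>
    have "AE \<omega> in lborel. AE x in torus_measure. ?F (\<omega>, x) = ?H (\<omega>, x)"
      using fg
    proof eventually_elim
      case (elim \<omega>)
      from AE_torus_rotation[OF elim, of "- (t *\<^sub>R \<omega>)"] AE_torus_fold_map[OF front l_pos]
      show ?case
        by eventually_elim (auto simp: gas_flow_def u_def GU indicator_def)
    qed
    from integral_gas_iterated[OF meas int this] show ?thesis
      by (simp add: gas_fraction_def)
  qed
  have "measure lebesgue G = measure lebesgue U"
  proof (rule measure_eq_AE)
    have Ul: "U \<in> sets lebesgue" using U(1) by simp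
    have "AE z in lebesgue. z \<notin> frontier G" using front by (intro AE_completion AE_not_in)
    then show "AE z in lebesgue. z \<in> G \<longleftrightarrow> z \<in> U" by eventually_elim (rule GU)
    have "negligible (G \<inter> frontier G)"
      using G_jordan negligible_subset[of "frontier G"] by (auto simp: jordan_measurable_def)
    \<comment> \<open>\<open>G\<close> is its interior together with a subset of a null set, hence
      Lebesgue measurable by completeness.\<close>
    then have "U \<union> (G \<inter> frontier G) \<in> sets lebesgue"
      using Ul negligible_imp_sets by blast
    also have "U \<union> (G \<inter> frontier G) = G"
      using GU interior_subset[of G] by (auto simp: U_def)
    finally show "G \<in> sets lebesgue" .
  qed (use U in simp)
  also have "\<dots> = measure lborel U" using U(1) by simp
  finally have mG: "measure lebesgue G = measure lborel U" .
  have mB: "measure lebesgue (gas_box l) = measure lborel (gas_box l)"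
    by (simp add: gas_box_eq_cbox)
  have "(gas_fraction l f G \<longlongrightarrow> measure lebesgue G / measure lebesgue (gas_box l)) at_infinity"
    using gas_equidistribution[OF g u u1 fold_map_mean(1)[OF l_pos U]]
      fold_map_mean(2)[OF l_pos U]
    by (simp add: total frac[abs_def] mG mB u_def)
  then show ?thesis
    using tendsto_mono[OF at_top_le_at_infinity] tendsto_mono[OF at_bot_le_at_infinity] by blast
qed

end
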